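(* In the setting described in the context, the two-step posterior update $$\hat p(s\mid\mathcal{D}_t)\propto p(s\mid\mathcal{D}_{t-1})\,p_{\text{top-}k}\bigl(q(\mathcal{B}_t)\mid s\bigr)^\lambda,\qquad p(s\mid\mathcal{D}_t)=\alpha/m+(1-\alpha)\,\hat p(s\mid\mathcal{D}_t),\qquad s\in\mathcal{S},$$ started from $p(s\mid \mathcal{D}_0)=1/m$, where $\hat p(\cdot\mid\mathcal{D}_t)$ is the intermediate distribution (normalized to sum to $1$ over $\mathcal{S}$) and $p(\cdot\mid\mathcal{D}_t)$ is the distribution carried into the next iteration, is equivalent to (produces the same sequence of distributions as) the fixed-share Hedge algorithm with learning rate $\lambda$ and mixing rate $\alpha$ applied to the loss sequence $\ell_t(s)=-\log p_{\text{top-}k}(q(\mathcal{B}_t)\mid s)$.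
   Context: $\mathcal{D}_{\text{tr}}$ is a finite nonempty training set and $\mathcal{S}$ is a fixed finite (indexed) family of $m$ real-valued functions on $\mathcal{D}_{\text{tr}}$, called strategies, of the form $\{f_1,-f_1,\dots,f_{m/2},-f_{m/2}\}$ with $m\ge2$ even. In the algorithm, the $f_j$ are drawn once at initialization from a Gaussian process prior and then held fixed. $\lambda>0$ is the learning rate and $\alpha\in[0,1)$ the mixing rate. At each iteration $t=1,2,\dots,T$ there is a batch $\mathcal{B}_t$ of $b$ elements of $\mathcal{D}_{\text{tr}}$ with observed real quality scores $q(\mathbf{z})$, $\mathbf{z}\in\mathcal{B}_t$. Let $\mathbf{z}_{(1)},\dots,\mathbf{z}_{(b)}$ be the elements of $\mathcal{B}_t$ sorted so that $q(\mathbf{z}_{(1)})\ge\dots\ge q(\mathbf{z}_{(b)})$ (ties broken in some fixed way). For an integer $1\le k\le b$ and a temperature $\beta>0$, the top-$k$ likelihood is $$p_{\text{top-}k}(q(\mathcal{B}_t)\mid s)=\prod_{j=1}^k\frac{\exp(s(\mathbf{z}_{(j)})/\beta)}{\sum_{i=1}^{b}\exp(s(\mathbf{z}_{(i)})/\beta)}.$$ The notation $p(\cdot\mid\mathcal{D}_t)$ denotes the distribution over $\mathcal{S}$ after the batches $\mathcal{B}_1,\dots,\mathcal{B}_t$ have been processed. Fixed-share Hedge (Herbster–Warmuth) with learning rate $\lambda$ and mixing rate $\alpha$ on a loss sequence $(\ell_t)$ over $m$ experts: start from the uniform distribution $w_0(s)=1/m$; at each $t$, perform the exponential-weights step $\hat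 w_t(s)\propto w_{t-1}(s)\exp(-\lambda\ell_t(s))$ (normalized to sum to $1$), followed by the uniform mixing step $w_t(s)=\alpha/m+(1-\alpha)\hat w_t(s)$. *)

theory Defs
  imports Complex_Main
begin

text \<open>
  The family \<open>f\<^sub>1, -f\<^sub>1, f\<^sub>2, -f\<^sub>2, \<dots>\<close>, indexed from 1. Distributions over strategies are
  functions of the index rather than of the strategy itself, so coinciding members of the family
  count separately.
\<close>
definition strategy :: "(nat \<Rightarrow> 'z \<Rightarrow> real) \<Rightarrow> nat \<Rightarrow> 'z \<Rightarrow> real" where
  "strategy f i = (if odd i then f ((i + 1) div 2) else (\<lambda>x. - f (i div 2) x))"

text \<open>
  \<open>z 1, \<dots>, z (card B)\<close> lists the elements of \<open>B\<close> by non-increasing score. Ties leave several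
  admissible \<open>z\<close>; any tie-breaking rule selects one of them.
\<close>
definition quality_ranking :: "('z \<Rightarrow> real) \<Rightarrow> 'z set \<Rightarrow> (nat \<Rightarrow> 'z) \<Rightarrow> bool" where
  "quality_ranking q B z \<longleftrightarrow>
     bij_betw z {1..card B} B \<and>
     (\<forall>i\<in>{1..card B}. \<forall>j\<in>{1..card B}. i \<le> j \<longrightarrow> q (z j) \<le> q (z i))"

text \<open>The scores enter only through the ranking \<open>z\<close>. The sum runs over the whole batch for every
  factor, not only over the elements not yet ranked.\<close>
definition topk_likelihood :: "real \<Rightarrow> nat \<Rightarrow> nat \<Rightarrow> (nat \<Rightarrow> 'z) \<Rightarrow> ('z \<Rightarrow> real) \<Rightarrow> real" where
  "topk_likelihood \<beta> k b z s =
     (\<Prod>j=1..k. exp (s (z j) / \<beta>) / (\<Sum>i=1..b. exp (s (z i) / \<beta>)))"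

definition is_distribution :: "'e set \<Rightarrow> ('e \<Rightarrow> real) \<Rightarrow> bool" where
  "is_distribution E p \<longleftrightarrow> (\<forall>s\<in>E. 0 \<le> p s) \<and> (\<Sum>s\<in>E. p s) = 1"

definition normalized :: "'e set \<Rightarrow> ('e \<Rightarrow> real) \<Rightarrow> 'e \<Rightarrow> real" where
  "normalized E u s = u s / (\<Sum>s'\<in>E. u s')"

definition hedge_step ::
    "'e set \<Rightarrow> real \<Rightarrow> ('e \<Rightarrow> real) \<Rightarrow> ('e \<Rightarrow> real) \<Rightarrow> 'e \<Rightarrow> real" where
  "hedge_step E \<eta> loss w = normalized E (\<lambda>s. w s * exp (- \<eta> * loss s))"

primrec fixed_share_hedge ::
    "'e set \<Rightarrow> real \<Rightarrow> real \<Rightarrow> (nat \<Rightarrow> 'e \<Rightarrow> real) \<Rightarrow> nat \<Rightarrow> 'e \<Rightarrow> real" where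
  "fixed_share_hedge E \<eta> \<alpha> loss 0 = (\<lambda>s. 1 / real (card E))"
| "fixed_share_hedge E \<eta> \<alpha> loss (Suc t) =
     (\<lambda>s. \<alpha> / real (card E) +
       (1 - \<alpha>) * hedge_step E \<eta> (loss (Suc t)) (fixed_share_hedge E \<eta> \<alpha> loss t) s)"

text \<open>The weights before mixing; meaningful for \<open>t \<ge> 1\<close>.\<close>
definition fixed_share_hedge_hat ::
    "'e set \<Rightarrow> real \<Rightarrow> real \<Rightarrow> (nat \<Rightarrow> 'e \<Rightarrow> real) \<Rightarrow> nat \<Rightarrow> 'e \<Rightarrow> real" where
  "fixed_share_hedge_hat E \<eta> \<alpha> loss t =
     hedge_step E \<eta> (loss t) (fixed_share_hedge E \<eta> \<alpha> loss (t - 1))"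

definition bayes_step ::
    "'e set \<Rightarrow> real \<Rightarrow> ('e \<Rightarrow> real) \<Rightarrow> ('e \<Rightarrow> real) \<Rightarrow> 'e \<Rightarrow> real" where
  "bayes_step E \<eta> lik p = normalized E (\<lambda>s. p s * lik s powr \<eta>)"

primrec posterior ::
    "'e set \<Rightarrow> real \<Rightarrow> real \<Rightarrow> (nat \<Rightarrow> 'e \<Rightarrow> real) \<Rightarrow> nat \<Rightarrow> 'e \<Rightarrow> real" where
  "posterior E \<eta> \<alpha> lik 0 = (\<lambda>s. 1 / real (card E))"
| "posterior E \<eta> \<alpha> lik (Suc t) =
     (\<lambda>s. \<alpha> / real (card E) +
       (1 - \<alpha>) * bayes_step E \<eta> (lik (Suc t)) (posterior E \<eta> \<alpha> lik t) s)"

text \<open>The posterior before mixing; meaningful for \<open>t \<ge> 1\<close>.\<close>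
definition posterior_hat ::
    "'e set \<Rightarrow> real \<Rightarrow> real \<Rightarrow> (nat \<Rightarrow> 'e \<Rightarrow> real) \<Rightarrow> nat \<Rightarrow> 'e \<Rightarrow> real" where
  "posterior_hat E \<eta> \<alpha> lik t =
     bayes_step E \<eta> (lik t) (posterior E \<eta> \<alpha> lik (t - 1))"

end

theory Submission
  imports Defs
begin

text \<open>For a positive likelihood p, p powr \<eta> = exp (\<eta> * ln p) = exp (- \<eta> * (- ln
  p)), so the Bayesian factor is exactly the Hedge factor for the loss - ln p. Softmax products are
  positive, hence a single unnormalized update agrees in both algorithms, and so does its
  normalization (\<open>bayes_step_eq_hedge_step\<close>). Start and mixing are the same, so
  induction on t gives \<open>posterior_eq_fixed_share_hedge\<close>; one more step from time t - 1
  gives the equality before mixing. That these weights are genuine distributions rests on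
  \<open>posterior_pos\<close>: all weights stay positive, so no normalizing sum vanishes, and
  mixing is a convex combination with the uniform distribution.\<close>

text \<open>Each factor is a quotient of positive numbers; \<open>1 \<le> b\<close> makes the sum in
  the denominator nonempty.\<close>

lemma topk_likelihood_pos:
  assumes "1 \<le> b"
  shows "0 < topk_likelihood \<beta> k b z s"
  using assms unfolding topk_likelihood_def
  by (intro prod_pos ballI divide_pos_pos sum_pos) auto

lemma normalized_cong:
  assumes "\<And>s. s \<in> E \<Longrightarrow> u s = v s" and "s \<in> E"
  shows "normalized E u s = normalized E v s"
  using assms by (simp add: normalized_def cong: sum.cong)

lemma normalized_pos:
  assumes "finite E" and "\<And>s. s \<in> E \<Longrightarrow> 0 < u s" and "s \<in> E"
  shows "0 < normalized E u s"
  unfolding normalized_def using assms by (intro divide_pos_pos sum_pos) auto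

lemma is_distribution_normalized:
  assumes "finite E" and "E \<noteq> {}" and "\<And>s. s \<in> E \<Longrightarrow> 0 < u s"
  shows "is_distribution E (normalized E u)"
proof -
  have "0 < (\<Sum>s\<in>E. u s)"
    using assms by (intro sum_pos) auto
  then have "(\<Sum>s\<in>E. normalized E u s) = 1"
    by (simp add: normalized_def flip: sum_divide_distrib)
  then show ?thesis
    using normalized_pos[OF assms(1,3)] by (simp add: is_distribution_def less_imp_le)
qed

lemma is_distribution_uniform:
  assumes "finite E" and "E \<noteq> {}"
  shows "is_distribution E (\<lambda>s. 1 / real (card E))"
  using assms by (simp add: is_distribution_def)

lemma is_distribution_mix:
  assumes "is_distribution E p" and "is_distribution E p'" and "0 \<le> \<alpha>" and "\<alpha> \<le> 1"
  shows "is_distribution E (\<lambda>s. \<alpha> * p s + (1 - \<alpha>) * p' s)"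
  using assms by (simp add: is_distribution_def sum.distrib flip: sum_distrib_left)

text \<open>The prior weights \<open>p\<close> and \<open>w\<close> need only agree on
  \<open>E\<close>, as the normalizing sum sees nothing else. In this form the lemma serves both as
  the induction step and for the weights before mixing.\<close>

lemma bayes_step_eq_hedge_step:
  assumes "\<And>s. s \<in> E \<Longrightarrow> 0 < lik s" and "\<And>s. s \<in> E \<Longrightarrow> p s = w s" and "s \<in> E"
  shows "bayes_step E \<eta> lik p s = hedge_step E \<eta> (\<lambda>s. - ln (lik s)) w s"
  unfolding bayes_step_def hedge_step_def
proof (rule normalized_cong[OF _ \<open>s \<in> E\<close>])
  fix s assume "s \<in> E"
  then have "0 < lik s" and "p s = w s"
    using assms by auto
  \<comment> \<open>For a nonzero base \<open>powr\<close> unfolds to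
    \<open>exp (\<eta> * ln (lik s))\<close>; at base 0 its value is 0, which no exponential
    attains. This is where positivity of the likelihood enters.\<close>
  then show "p s * lik s powr \<eta> = w s * exp (- \<eta> * - ln (lik s))"
    by (simp add: powr_def)
qed

lemma posterior_pos:
  assumes "finite E" and "0 \<le> \<alpha>" and "\<alpha> < 1"
    and "\<And>t s. s \<in> E \<Longrightarrow> 0 < lik t s" and "s \<in> E"
  shows "0 < posterior E \<eta> \<alpha> lik t s"
  using \<open>s \<in> E\<close>
proof (induction t arbitrary: s)
  case 0
  then show ?case
    using assms(1) by (auto simp: card_gt_0_iff)
next
  case (Suc t)
  have "0 < bayes_step E \<eta> (lik (Suc t)) (posterior E \<eta> \<alpha> lik t) s"
    unfolding bayes_step_def
  proof (rule normalized_pos[OF assms(1) _ \<open>s \<in> E\<close>])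
    fix s assume "s \<in> E"
    then show "0 < posterior E \<eta> \<alpha> lik t s * lik (Suc t) s powr \<eta>"
      using Suc.IH assms(4)[of s "Suc t"] by simp
  qed
  \<comment> \<open>The uniform share is nonnegative, and \<open>\<alpha> < 1\<close> keeps the
    other summand strictly positive, even when \<alpha> = 0.\<close>
  then show ?case
    using assms(2,3) by (simp add: add_nonneg_pos)
qed

lemma is_distribution_posterior_hat:
  assumes "finite E" and "E \<noteq> {}" and "0 \<le> \<alpha>" and "\<alpha> < 1"
    and lik: "\<And>t s. s \<in> E \<Longrightarrow> 0 < lik t s"
  shows "is_distribution E (posterior_hat E \<eta> \<alpha> lik t)"
  unfolding posterior_hat_def bayes_step_def
proof (rule is_distribution_normalized[OF assms(1,2)])
  fix s assume "s \<in> E"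
  then show "0 < posterior E \<eta> \<alpha> lik (t - 1) s * lik t s powr \<eta>"
    using posterior_pos[OF assms(1,3,4) lik] lik[of s t] by simp
qed

lemma is_distribution_posterior:
  assumes "finite E" and "E \<noteq> {}" and "0 \<le> \<alpha>" and "\<alpha> < 1"
    and "\<And>t s. s \<in> E \<Longrightarrow> 0 < lik t s"
  shows "is_distribution E (posterior E \<eta> \<alpha> lik t)"
proof (cases t)
  case 0
  then show ?thesis
    using is_distribution_uniform[OF assms(1,2)] by simp
next
  case (Suc t')
  \<comment> \<open>At a successor time the posterior is the mixture, with weights \<alpha> and 1 -
    \<alpha>, of the uniform distribution and \<open>posterior_hat\<close> at that same
    time.\<close>
  then show ?thesis
    using is_distribution_mix[OF is_distribution_uniform[OF assms(1,2)]
        is_distribution_posterior_hat[of E \<alpha> lik \<eta> t], of \<alpha>] assms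
    by (simp add: posterior_hat_def)
qed

lemma posterior_eq_fixed_share_hedge:
  assumes "\<And>t s. s \<in> E \<Longrightarrow> 0 < lik t s" and "s \<in> E"
  shows "posterior E \<eta> \<alpha> lik t s = fixed_share_hedge E \<eta> \<alpha> (\<lambda>t s. - ln (lik t s)) t s"
  using \<open>s \<in> E\<close>
proof (induction t arbitrary: s)
  case 0
  show ?case by simp
next
  case (Suc t)
  then show ?case
    using bayes_step_eq_hedge_step[of E "lik (Suc t)"] assms(1) by simp
qed

text \<open>Both sides are one step from the carried weights at t - 1, which already agree on
  \<open>E\<close>.\<close>

lemma posterior_hat_eq_fixed_share_hedge_hat:
  assumes "\<And>t s. s \<in> E \<Longrightarrow> 0 < lik t s" and "s \<in> E"
  shows "posterior_hat E \<eta> \<alpha> lik t s =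
    fixed_share_hedge_hat E \<eta> \<alpha> (\<lambda>t s. - ln (lik t s)) t s"
  unfolding posterior_hat_def fixed_share_hedge_hat_def
  by (intro bayes_step_eq_hedge_step posterior_eq_fixed_share_hedge assms)

theorem proposition1:
  fixes D :: "'z set"
    and f :: "nat \<Rightarrow> 'z \<Rightarrow> real"
    and q :: "nat \<Rightarrow> 'z \<Rightarrow> real"
    and B :: "nat \<Rightarrow> 'z set"
    and z :: "nat \<Rightarrow> nat \<Rightarrow> 'z"
    and m b k T :: nat
    and \<eta> \<alpha> \<beta> :: real
  assumes "finite D" and "D \<noteq> {}"
    and "even m" and "2 \<le> m"
    and "0 < \<eta>" and "0 \<le> \<alpha>" and "\<alpha> < 1" and "0 < \<beta>"
    and "1 \<le> k" and "k \<le> b"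
    and "\<And>t. t \<in> {1..T} \<Longrightarrow> B t \<subseteq> D"
    and "\<And>t. t \<in> {1..T} \<Longrightarrow> card (B t) = b"
    and "\<And>t. t \<in> {1..T} \<Longrightarrow> quality_ranking (q t) (B t) (z t)"
  shows
    "let S = {1..m};
         lik = (\<lambda>t i. topk_likelihood \<beta> k b (z t) (strategy f i));
         loss = (\<lambda>t i. - ln (lik t i))
     in (\<forall>t\<in>{0..T}. is_distribution S (posterior S \<eta> \<alpha> lik t)) \<and>
        (\<forall>t\<in>{1..T}. is_distribution S (posterior_hat S \<eta> \<alpha> lik t)) \<and>
        (\<forall>t\<in>{0..T}. \<forall>i\<in>S.
           posterior S \<eta> \<alpha> lik t i = fixed_share_hedge S \<eta> \<alpha> loss t i) \<and>
        (\<forall>t\<in>{1..T}. \<forall>i\<in>S.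
           posterior_hat S \<eta> \<alpha> lik t i = fixed_share_hedge_hat S \<eta> \<alpha> loss t i)"
proof -
  \<comment> \<open>Positivity holds for every t, also outside {1..T}, as the general lemmas
    require; \<open>1 \<le> b\<close> follows from \<open>1 \<le> k\<close> and
    \<open>k \<le> b\<close>.\<close>
  have lik: "0 < topk_likelihood \<beta> k b (z t) (strategy f i)" for t i
    using assms(9,10) by (intro topk_likelihood_pos) linarith
  have S: "finite {1..m}" "{1..m} \<noteq> {}"
    using assms(4) by auto
  show ?thesis
    unfolding Let_def
    by (intro conjI ballI is_distribution_posterior is_distribution_posterior_hat
        posterior_eq_fixed_share_hedge posterior_hat_eq_fixed_share_hedge_hat lik S assms(6,7))
qed

end
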